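(* Let $\mathbb{K}$ be a field, $S=\mathbb{K}[x_1,\ldots,x_n]$, let $T=\{m_1,\ldots,m_t\}$ be a (nonempty, finite) set of square-free monomials of degree $s$ in $S$, and let $I=\mathrm{sfBorel}(T)$. Then $$\widehat{\alpha}(\mathrm{sfBorel}(m_1\vee \cdots\vee m_t))\leq \widehat{\alpha}(I)\leq \widehat{\alpha}(\mathrm{sfBorel}(m_1\wedge\cdots \wedge m_t)).$$
   Context: Square-free Borel ideals. For a monomial $m$, a Borel move of $m$ is a monomial $m\cdot\frac{x_{a_1}}{x_{b_1}}\cdots\frac{x_{a_q}}{x_{b_q}}$ with $a_p<b_p$ and $x_{b_p}\mid m$ for all $p$ (the trivial move giving $m$ itself is allowed). For a set $T$ of square-free monomials, $\mathrm{sfBorel}(T)$ is the ideal of $S$ generated by all square-free monomials that can be obtained by Borel moves from elements of $T$; for $T=\{m\}$ one writes $\mathrm{sfBorel}(m)$. Equivalently, for $m=x_{i_1}\cdots x_{i_s}$ with $i_1<\cdots<i_s$, $\mathrm{sfBorel}(m)$ is generated by all $x_{j_1}\cdots x_{j_s}$ with $j_1<\cdots<j_s$ and $j_p\le i_p$ for all $p$, and $\mathrm{sfBorel}(T)=\sum_{m\in T}\mathrm{sfBorel}(m)$. Join and meet. For square-free monomials $m_1=x_{i_1}\cdots x_{i_s}$ and $m_2=x_{j_1}\cdots x_{j_s}$ of the same degree (indices written in increasing order), $m_1\vee m_2=x_{k_1}\cdots x_{k_s}$ with $k_r=\max\{i_r,j_r\}$, and $m_1\wedge m_2=x_{l_1}\cdots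 x_{l_s}$ with $l_r=\min\{i_r,j_r\}$, for $1\le r\le s$; these are extended to several monomials by iterating. Waldschmidt constant. For a square-free monomial ideal $L\subseteq S$ with minimal primary decomposition $L=P_1\cap\cdots\cap P_t$ (the $P_i$ prime), the $q$-th symbolic power is $L^{(q)}=P_1^q\cap\cdots\cap P_t^q$. Write $\alpha(J)$ for the smallest degree of a generator of a homogeneous ideal $J$. Then $\widehat{\alpha}(L)=\lim_{q\to\infty}\alpha(L^{(q)})/q$. *)

theory Defs
  imports Complex_Main "HOL-Library.Poly_Mapping" "HOL-Algebra.Ideal_Product"
begin

text \<open>
  A monomial is identified with its exponent vector: \<open>m\<close> stands for
  the product of the powers of \<open>x\<^sub>i\<close> with exponent \<open>Poly_Mapping.lookup m i\<close>. Exponent vectors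
  are written additively, so \<open>m + m'\<close> is the product of monomials and
  \<open>Poly_Mapping.single i 1\<close> is \<open>x\<^sub>i\<close>.
\<close>

type_synonym monomial = "nat \<Rightarrow>\<^sub>0 nat"
type_synonym 'k polynomial = "monomial \<Rightarrow>\<^sub>0 'k"

definition mon_in :: "nat \<Rightarrow> monomial \<Rightarrow> bool"
  where "mon_in n m \<longleftrightarrow> Poly_Mapping.keys m \<subseteq> {1..n}"

definition mon_degree :: "monomial \<Rightarrow> nat"
  where "mon_degree m = (\<Sum>i\<in>Poly_Mapping.keys m. Poly_Mapping.lookup m i)"

definition squarefree_mon :: "monomial \<Rightarrow> bool"
  where "squarefree_mon m \<longleftrightarrow> (\<forall>i. Poly_Mapping.lookup m i \<le> 1)"

text \<open>The ring \<open>K[x\<^sub>1, \<dots>, x\<^sub>n]\<close>, as a record, so that the ideal theory of \<open>HOL-Algebra\<close>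
  applies to it.\<close>

definition poly_ring :: "nat \<Rightarrow> 'k::field polynomial ring"
  where "poly_ring n =
    \<lparr> carrier = {f. \<forall>m\<in>Poly_Mapping.keys f. mon_in n m},
      monoid.mult = (*), one = 1, ring.zero = 0, add = (+) \<rparr>"

lemma cring_poly_ring: "cring (poly_ring n :: 'k::field polynomial ring)"
proof (intro cringI abelian_groupI comm_monoidI)
  fix f g :: "'k polynomial"
  assume fg: "f \<in> carrier (poly_ring n)" "g \<in> carrier (poly_ring n)"
  have *: "mon_in n (m + m')" if "mon_in n m" "mon_in n m'" for m m'
    using that Poly_Mapping.keys_add[of m m'] unfolding mon_in_def by blast
  show "f \<otimes>\<^bsub>poly_ring n\<^esub> g \<in> carrier (poly_ring n)"
    using fg keys_mult[of f g] * unfolding poly_ring_def by fastforce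
  show "f \<oplus>\<^bsub>poly_ring n\<^esub> g \<in> carrier (poly_ring n)"
    using fg Poly_Mapping.keys_add[of f g] unfolding poly_ring_def by auto
next
  fix f :: "'k polynomial"
  assume "f \<in> carrier (poly_ring n)"
  then show "\<exists>g\<in>carrier (poly_ring n). g \<oplus>\<^bsub>poly_ring n\<^esub> f = \<zero>\<^bsub>poly_ring n\<^esub>"
    by (intro bexI[of _ "- f"]) (auto simp: poly_ring_def)
qed (auto simp: poly_ring_def mon_in_def algebra_simps)

text \<open>
  \<open>m'\<close> is the Borel move of \<open>m\<close> given by the list \<open>ps\<close> of the pairs \<open>(a\<^sub>p, b\<^sub>p)\<close>.
  The equation \<open>m' = m \<cdot> \<Prod>\<^sub>p x\<^bsub>a\<^sub>p\<^esub> / \<Prod>\<^sub>p x\<^bsub>b\<^sub>p\<^esub>\<close> is cleared of denominators, which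
  also expresses that the quotient is again a monomial.
\<close>

definition borel_move :: "monomial \<Rightarrow> monomial \<Rightarrow> bool"
  where "borel_move m m' \<longleftrightarrow>
    (\<exists>ps. (\<forall>(a, b)\<in>set ps. 1 \<le> a \<and> a < b \<and> b \<in> Poly_Mapping.keys m) \<and>
          m' + (\<Sum>(a, b)\<leftarrow>ps. Poly_Mapping.single b 1) =
          m + (\<Sum>(a, b)\<leftarrow>ps. Poly_Mapping.single a 1))"

definition sfBorel :: "nat \<Rightarrow> monomial set \<Rightarrow> 'k::field polynomial set"
  where "sfBorel n T =
    Idl\<^bsub>poly_ring n\<^esub> {Poly_Mapping.single m' 1 | m'. squarefree_mon m' \<and> (\<exists>m\<in>T. borel_move m m')}"

text \<open>The following are meant for square-free monomials, of equal degree in the case of join and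
  meet: \<open>mon_indices\<close> lists \<open>i\<^sub>1 < \<dots> < i\<^sub>s\<close> for the monomial \<open>x\<^bsub>i\<^sub>1\<^esub> \<cdots> x\<^bsub>i\<^sub>s\<^esub>\<close>.\<close>

definition mon_indices :: "monomial \<Rightarrow> nat list"
  where "mon_indices m = sorted_list_of_set (Poly_Mapping.keys m)"

definition mon_of_indices :: "nat list \<Rightarrow> monomial"
  where "mon_of_indices is = (\<Sum>i\<leftarrow>is. Poly_Mapping.single i 1)"

definition mon_join :: "monomial \<Rightarrow> monomial \<Rightarrow> monomial"
  where "mon_join m m' = mon_of_indices (map2 max (mon_indices m) (mon_indices m'))"

definition mon_meet :: "monomial \<Rightarrow> monomial \<Rightarrow> monomial"
  where "mon_meet m m' = mon_of_indices (map2 min (mon_indices m) (mon_indices m'))"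

text \<open>For nonempty lists only.\<close>

definition mon_joins :: "monomial list \<Rightarrow> monomial"
  where "mon_joins ms = foldl mon_join (hd ms) (tl ms)"

definition mon_meets :: "monomial list \<Rightarrow> monomial"
  where "mon_meets ms = foldl mon_meet (hd ms) (tl ms)"

text \<open>
  A minimal primary decomposition all of whose components are prime: the components are pairwise
  distinct (being the elements of a set), hence have distinct radicals, and none of them
  contains the intersection of the others. The intersection with the carrier makes the empty
  intersection the whole ring.
\<close>

definition min_prime_decomp :: "('a, 'b) ring_scheme \<Rightarrow> 'a set \<Rightarrow> 'a set set \<Rightarrow> bool"
  where "min_prime_decomp R L \<P> \<longleftrightarrow>
    finite \<P> \<and> (\<forall>P\<in>\<P>. primeideal P R) \<and> L = carrier R \<inter> \<Inter>\<P> \<and>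
    (\<forall>P\<in>\<P>. \<not> carrier R \<inter> \<Inter>(\<P> - {P}) \<subseteq> P)"

text \<open>Meaningful if \<open>L\<close> has such a decomposition (which is then unique), in particular for
  square-free monomial ideals. Powers of ideals are powers in the semiring of ideals.\<close>

definition symbolic_power :: "('a, 'b) ring_scheme \<Rightarrow> 'a set \<Rightarrow> nat \<Rightarrow> 'a set"
  where "symbolic_power R L q =
    carrier R \<inter> (\<Inter>P\<in>(THE \<P>. min_prime_decomp R L \<P>). P [^]\<^bsub>ideals_set R\<^esub> q)"

definition homogeneous :: "nat \<Rightarrow> 'k::zero polynomial \<Rightarrow> bool"
  where "homogeneous d f \<longleftrightarrow> (\<forall>m\<in>Poly_Mapping.keys f. mon_degree m = d)"

definition homogeneous_generators :: "nat \<Rightarrow> 'k::field polynomial set \<Rightarrow> 'k polynomial set \<Rightarrow> bool"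
  where "homogeneous_generators n J G \<longleftrightarrow>
    G \<subseteq> carrier (poly_ring n) \<and> J = Idl\<^bsub>poly_ring n\<^esub> G \<and>
    (\<forall>g\<in>G. g \<noteq> 0 \<and> (\<exists>d. homogeneous d g))"

text \<open>The smallest degree of a generator; the smallest degree occurring in a set of nonzero
  homogeneous generators of \<open>J\<close> does not depend on the set. Only used for nonzero homogeneous
  ideals.\<close>

definition initial_degree :: "nat \<Rightarrow> 'k::field polynomial set \<Rightarrow> nat"  (\<open>\<alpha>\<close>)
  where "\<alpha> n J = (LEAST d. \<exists>G g. homogeneous_generators n J G \<and> g \<in> G \<and> homogeneous d g)"

definition waldschmidt :: "nat \<Rightarrow> 'k::field polynomial set \<Rightarrow> real"
  where "waldschmidt n L = lim (\<lambda>q. real (\<alpha> n (symbolic_power (poly_ring n) L q)) / real q)"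

end

theory Submission
  imports Defs
begin

text \<open>
  The Waldschmidt constant reverses inclusions between nonzero square-free monomial ideals, and
  \<open>sfBorel(m\<^sub>1 \<and> \<dots> \<and> m\<^sub>t) \<subseteq> sfBorel(T) \<subseteq> sfBorel(m\<^sub>1 \<or> \<dots> \<or> m\<^sub>t)\<close>.

  The inclusions hold because a square-free monomial \<open>m'\<close> is a Borel move of a square-free monomial
  \<open>m\<close> iff the index lists satisfy \<open>j\<^sub>p \<le> i\<^sub>p\<close> for all \<open>p\<close> (\<open>borel_move_imp_borel_le\<close>,
  \<open>borel_le_imp_borel_move\<close>). This relation is a preorder, and for it the meet lies below every
  \<open>m\<^sub>r\<close> and the join above.

  For the Waldschmidt constant let \<open>L \<subseteq> L'\<close>. A prime component \<open>P'\<close> of \<open>L'\<close> contains the intersection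
  of the components of \<open>L\<close> and so, being prime, one of them, say \<open>P\<close>; then the \<open>q\<close>-th power of \<open>P\<close>
  is contained in that of \<open>P'\<close>. Thus the \<open>q\<close>-th symbolic power of \<open>L\<close> is contained in that of \<open>L'\<close>
  (\<open>symbolic_power_mono\<close>), and the latter contains elements of degree as small as the former. To
  pass to the limit, the quotients of the initial degrees by \<open>q\<close> must converge. This is Fekete's lemma
  (\<open>subadditive_convergent\<close>): symbolic powers multiply into symbolic powers, and the
  polynomial ring is a domain (\<open>waldschmidt_limit\<close>).

  The argument with symbolic powers is valid in every commutative ring, provided that the ideals
  have minimal decompositions into primes; these are automatically unique. A square-free monomial
  ideal has one, because it is the intersection of the ideals generated by the sets of variables
  that meet every generator (\<open>squarefree_ideal_eq_Inter\<close>). The components, their powers and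
  hence the symbolic powers are spanned by monomials, which allows the initial degree to be computed
  from arbitrary nonzero homogeneous elements (\<open>initial_degree_le\<close>).
\<close>

section \<open>Symbolic powers in a commutative ring\<close>

lemma ideals_set_simps [simp]:
  "\<one>\<^bsub>ideals_set R\<^esub> = carrier R" "A \<otimes>\<^bsub>ideals_set R\<^esub> B = A \<cdot>\<^bsub>R\<^esub> B"
  by (simp_all add: ideals_set_def)

lemma ideal_prod_mono:
  assumes "A \<subseteq> A'" "B \<subseteq> B'"
  shows "A \<cdot>\<^bsub>R\<^esub> B \<subseteq> A' \<cdot>\<^bsub>R\<^esub> B'"
proof
  fix x assume "x \<in> A \<cdot>\<^bsub>R\<^esub> B"
  then show "x \<in> A' \<cdot>\<^bsub>R\<^esub> B'"
    by induction (use assms in \<open>auto intro: ideal_prod.intros\<close>)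
qed

lemma ideal_pow_mono:
  assumes "P \<subseteq> Q"
  shows "P [^]\<^bsub>ideals_set R\<^esub> (q::nat) \<subseteq> Q [^]\<^bsub>ideals_set R\<^esub> q"
  by (induction q) (auto dest: ideal_prod_mono[OF _ assms, THEN subsetD])

context cring
begin

lemma ideal_pow_ideal:
  assumes "ideal P R"
  shows "ideal (P [^]\<^bsub>ideals_set R\<^esub> (q::nat)) R"
  by (induction q) (auto simp: oneideal ideal_prod_is_ideal assms)

lemma ideal_pow_mult_closed:
  assumes P: "ideal P R" and x: "x \<in> P [^]\<^bsub>ideals_set R\<^esub> (p::nat)"
    and y: "y \<in> P [^]\<^bsub>ideals_set R\<^esub> (q::nat)"
  shows "x \<otimes> y \<in> P [^]\<^bsub>ideals_set R\<^esub> (p + q)"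
  using y
proof (induction q arbitrary: y)
  case 0
  then show ?case
    using x ideal.I_r_closed[OF ideal_pow_ideal[OF P]] by simp
next
  case (Suc q)
  have xc: "x \<in> carrier R" using x ideal.Icarr[OF ideal_pow_ideal[OF P]] by blast
  have sub: "(P [^]\<^bsub>ideals_set R\<^esub> q) \<cdot> P \<subseteq> carrier R"
    using ideal_prod_in_carrier ideal_pow_ideal P by blast
  have "y \<in> (P [^]\<^bsub>ideals_set R\<^esub> q) \<cdot> P" using Suc.prems by simp
  then have "x \<otimes> y \<in> (P [^]\<^bsub>ideals_set R\<^esub> (p + q)) \<cdot> P"
  proof induction
    case (prod i j)
    have "i \<in> carrier R" "j \<in> carrier R"
      using prod ideal.Icarr[OF ideal_pow_ideal[OF P]] ideal.Icarr[OF P] by blast+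
    then have "x \<otimes> (i \<otimes> j) = (x \<otimes> i) \<otimes> j" using xc by (simp add: m_assoc)
    then show ?case using Suc.IH prod by (auto intro: ideal_prod.prod)
  next
    case (sum a b)
    then have "x \<otimes> (a \<oplus> b) = x \<otimes> a \<oplus> x \<otimes> b"
      using xc sub by (intro r_distr) auto
    then show ?case using sum by (auto intro: ideal_prod.sum)
  qed
  then show ?case by simp
qed

lemma pow_in_ideal_pow:
  assumes "ideal P R" "x \<in> P"
  shows "x [^] (q::nat) \<in> P [^]\<^bsub>ideals_set R\<^esub> q"
  by (induction q) (auto simp: assms intro: ideal_prod.prod)

text \<open>If no component were contained in \<open>P\<close>, a product of elements of the components outside of
  \<open>P\<close> would lie in the intersection and not in \<open>P\<close>.\<close>
lemma primeideal_contains_component: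
  assumes P: "primeideal P R" and fin: "finite \<Q>" and ids: "\<And>Q. Q \<in> \<Q> \<Longrightarrow> ideal Q R"
    and sub: "carrier R \<inter> \<Inter>\<Q> \<subseteq> P"
  obtains Q where "Q \<in> \<Q>" "Q \<subseteq> P"
proof -
  interpret P: primeideal P R by fact
  have "\<exists>Q\<in>\<Q>. Q \<subseteq> P" using fin ids sub
  proof (induction \<Q> rule: finite_induct)
    case empty
    then show ?case using P.I_notcarr P.Icarr by auto
  next
    case (insert Q \<Q>)
    show ?case
    proof (cases "Q \<subseteq> P")
      case False
      then obtain x where x: "x \<in> Q" "x \<notin> P" by blast
      interpret Q: ideal Q R using insert.prems by simp
      have "carrier R \<inter> \<Inter>\<Q> \<subseteq> P"
      proof
        fix y assume y: "y \<in> carrier R \<inter> \<Inter>\<Q>"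
        have "x \<otimes> y \<in> Q" using x y Q.I_r_closed by blast
        moreover have "x \<otimes> y \<in> Q'" if "Q' \<in> \<Q>" for Q'
          using that insert.prems(1)[of Q'] y x ideal.I_l_closed[of Q' R y x] Q.Icarr by blast
        ultimately have "x \<otimes> y \<in> P" using insert.prems(2) Q.Icarr by blast
        then show "y \<in> P" using P.I_prime x y Q.Icarr by blast
      qed
      then show ?thesis using insert by blast
    qed auto
  qed
  then show ?thesis using that by blast
qed

lemma min_prime_decomp_refines:
  assumes D: "min_prime_decomp R L \<P>" and D': "min_prime_decomp R L' \<P>'"
    and "L \<subseteq> L'" "P' \<in> \<P>'"
  obtains P where "P \<in> \<P>" "P \<subseteq> P'"
proof -
  have "carrier R \<inter> \<Inter>\<P> \<subseteq> P'"
    using assms unfolding min_prime_decomp_def by blast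
  then show ?thesis
    using primeideal_contains_component[of P' \<P>] assms primeideal.axioms(1) that
    unfolding min_prime_decomp_def by metis
qed

text \<open>A component of one decomposition contains a component of the other, which in turn contains a
  component of the first; as no component of the first is redundant, all three are equal.\<close>
lemma min_prime_decomp_subset:
  assumes D: "min_prime_decomp R L \<P>" and D': "min_prime_decomp R L \<P>'"
  shows "\<P> \<subseteq> \<P>'"
proof
  fix P assume P: "P \<in> \<P>"
  obtain Q where Q: "Q \<in> \<P>'" "Q \<subseteq> P" using min_prime_decomp_refines[OF D' D _ P] by blast
  obtain P2 where P2: "P2 \<in> \<P>" "P2 \<subseteq> Q" using min_prime_decomp_refines[OF D D' _ Q(1)] by blast
  have "P2 = P"
  proof (rule ccontr)
    assume "P2 \<noteq> P"
    then have "carrier R \<inter> \<Inter>(\<P> - {P}) \<subseteq> P" using P2 Q by blast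
    then show False using D P unfolding min_prime_decomp_def by blast
  qed
  then have "Q = P" using P2 Q by simp
  then show "P \<in> \<P>'" using Q by simp
qed

lemma symbolic_power_eq:
  assumes "min_prime_decomp R L \<P>"
  shows "symbolic_power R L q = carrier R \<inter> (\<Inter>P\<in>\<P>. P [^]\<^bsub>ideals_set R\<^esub> q)"
proof -
  have "(THE \<P>. min_prime_decomp R L \<P>) = \<P>"
    using assms min_prime_decomp_subset by (intro the_equality) blast+
  then show ?thesis by (simp add: symbolic_power_def)
qed

text \<open>A component that contains the intersection of the others can be dropped; a subset of least
  cardinality with the same intersection has none.\<close>
lemma min_prime_decomp_exists:
  assumes "finite \<P>" and "\<And>P. P \<in> \<P> \<Longrightarrow> primeideal P R" and "L = carrier R \<inter> \<Inter>\<P>"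
  obtains \<Q> where "\<Q> \<subseteq> \<P>" "min_prime_decomp R L \<Q>"
proof -
  define D where "D \<Q> \<longleftrightarrow> \<Q> \<subseteq> \<P> \<and> L = carrier R \<inter> \<Inter>\<Q>" for \<Q>
  obtain \<Q> where Q: "D \<Q>" and least: "\<And>\<Q>'. D \<Q>' \<Longrightarrow> card \<Q> \<le> card \<Q>'"
    using ex_has_least_nat[of D \<P> card] assms(3) unfolding D_def by blast
  have fin: "finite \<Q>" using Q assms(1) finite_subset unfolding D_def by blast
  have "\<not> carrier R \<inter> \<Inter>(\<Q> - {P}) \<subseteq> P" if P: "P \<in> \<Q>" for P
  proof
    assume "carrier R \<inter> \<Inter>(\<Q> - {P}) \<subseteq> P"
    then have "D (\<Q> - {P})" using Q P unfolding D_def by auto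
    then show False using least card_Diff1_less[OF fin P] by fastforce
  qed
  then show ?thesis using that[of \<Q>] Q fin assms(2) unfolding D_def min_prime_decomp_def by blast
qed

text \<open>Every component \<open>P'\<close> of the larger ideal contains a component \<open>P\<close> of the smaller one, and
  hence the powers of \<open>P'\<close> contain those of \<open>P\<close>.\<close>
lemma symbolic_power_mono:
  assumes D: "min_prime_decomp R L \<P>" and D': "min_prime_decomp R L' \<P>'" and "L \<subseteq> L'"
  shows "symbolic_power R L q \<subseteq> symbolic_power R L' q"
proof -
  have "(\<Inter>P\<in>\<P>. P [^]\<^bsub>ideals_set R\<^esub> q) \<subseteq> P' [^]\<^bsub>ideals_set R\<^esub> q" if P': "P' \<in> \<P>'" for P'
  proof -
    obtain P where P: "P \<in> \<P>" "P \<subseteq> P'" using min_prime_decomp_refines[OF D D' assms(3) P'] .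
    show ?thesis using INT_lower[OF P(1)] ideal_pow_mono[OF P(2)] by (rule subset_trans)
  qed
  then have "(\<Inter>P\<in>\<P>. P [^]\<^bsub>ideals_set R\<^esub> q) \<subseteq> (\<Inter>P'\<in>\<P>'. P' [^]\<^bsub>ideals_set R\<^esub> q)"
    by (rule INT_greatest)
  then show ?thesis unfolding symbolic_power_eq[OF D] symbolic_power_eq[OF D']
    by (rule Int_mono[OF subset_refl])
qed

lemma symbolic_power_mult_closed:
  assumes D: "min_prime_decomp R L \<P>"
    and "x \<in> symbolic_power R L p" "y \<in> symbolic_power R L q"
  shows "x \<otimes> y \<in> symbolic_power R L (p + q)"
proof -
  have "ideal P R" if "P \<in> \<P>" for P
    using D that primeideal.axioms(1) unfolding min_prime_decomp_def by metis
  then have "x \<otimes> y \<in> P [^]\<^bsub>ideals_set R\<^esub> (p + q)" if "P \<in> \<P>" for P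
    using assms(2,3) that by (intro ideal_pow_mult_closed) (auto simp: symbolic_power_eq[OF D])
  then show ?thesis
    using assms(2,3) by (auto simp: symbolic_power_eq[OF D])
qed

lemma pow_in_symbolic_power:
  assumes D: "min_prime_decomp R L \<P>" and "x \<in> L"
  shows "x [^] q \<in> symbolic_power R L q"
proof -
  have "x [^] q \<in> P [^]\<^bsub>ideals_set R\<^esub> q" if "P \<in> \<P>" for P
  proof (rule pow_in_ideal_pow)
    show "ideal P R" using D that primeideal.axioms(1) unfolding min_prime_decomp_def by metis
    show "x \<in> P" using D that assms(2) unfolding min_prime_decomp_def by simp
  qed
  moreover have "x \<in> carrier R" using D assms(2) unfolding min_prime_decomp_def by simp
  ultimately show ?thesis by (auto simp: symbolic_power_eq[OF D])
qed

end

section \<open>Subadditive sequences\<close>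

text \<open>Fekete's lemma: the limit is the infimum \<open>l\<close> of the quotients. If \<open>a k / k\<close> is close to \<open>l\<close>,
  division of \<open>q\<close> by \<open>k\<close> with remainder bounds \<open>a q / q\<close> by \<open>a k / k\<close> up to an error of order
  \<open>1 / q\<close>.\<close>
lemma subadditive_convergent:
  fixes a :: "nat \<Rightarrow> real"
  assumes sub: "\<And>p q. a (p + q) \<le> a p + a q" and nonneg: "\<And>q. 0 \<le> a q"
  shows "convergent (\<lambda>q. a q / real q)"
proof -
  \<comment> \<open>The infimum is over positive \<open>q\<close> only, since \<open>a 0 / 0 = 0\<close>.\<close>
  define l where "l = (INF q\<in>{1..}. a q / real q)"
  have bdd: "bdd_below ((\<lambda>q. a q / real q) ` {1..})"
    by (rule bdd_belowI2[of _ 0]) (simp add: nonneg)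
  have mult: "a (c * k + r) \<le> real c * a k + a r" for c k r
  proof (induction c)
    case (Suc c)
    have "a (Suc c * k + r) \<le> a k + a (c * k + r)"
      using sub[of k "c * k + r"] by (simp add: add.assoc)
    then show ?case using Suc by (simp add: algebra_simps)
  qed simp
  have "(\<lambda>q. a q / real q) \<longlonglongrightarrow> l"
  proof (rule LIMSEQ_I)
    fix e :: real assume e: "0 < e"
    obtain k where k: "1 \<le> k" "a k / real k < l + e / 2"
      using cINF_less_iff[OF _ bdd, of "l + e / 2"] e unfolding l_def by auto
    \<comment> \<open>\<open>M\<close> bounds \<open>a\<close> at all remainders modulo \<open>k\<close>.\<close>
    define M where "M = (\<Sum>r<k. a r)"
    have M: "a r \<le> M" if "r < k" for r
      unfolding M_def using that nonneg by (intro member_le_sum) auto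
    obtain N :: nat where N: "2 * M / e < real N" using reals_Archimedean2 by blast
    show "\<exists>N. \<forall>q\<ge>N. norm (a q / real q - l) < e"
    proof (intro exI allI impI)
      fix q assume q: "q \<ge> Suc N"
      have qpos: "0 < real q" using q by simp
      have "l \<le> a q / real q" unfolding l_def using q by (intro cINF_lower[OF bdd]) auto
      moreover have "a q / real q < l + e"
      proof -
        have "a q \<le> real (q div k) * a k + a (q mod k)"
          using mult[of "q div k" k "q mod k"] by simp
        also have "\<dots> \<le> real (q div k) * a k + M" using M k by simp
        also have "real (q div k) * a k \<le> (real q / real k) * a k"
          using of_nat_div_le_of_nat[of q k] nonneg by (intro mult_right_mono) auto
        finally have "a q \<le> real q * (a k / real k) + M" by simp
        also have "\<dots> \<le> real q * (l + e / 2) + M"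
          using k qpos by (intro add_right_mono mult_left_mono) auto
        also have "M < real q * (e / 2)"
        proof -
          have "2 * M / e < real q" using N q by simp
          then show ?thesis using e by (simp add: field_simps)
        qed
        finally have "a q < real q * (l + e)" by (simp add: algebra_simps)
        then show ?thesis using qpos by (simp add: field_simps)
      qed
      ultimately show "norm (a q / real q - l) < e" by simp
    qed
  qed
  then show ?thesis by (rule convergentI)
qed

section \<open>Monomial ideals\<close>

lemma poly_ring_simps [simp]:
  "f \<otimes>\<^bsub>poly_ring n\<^esub> g = f * g" "f \<oplus>\<^bsub>poly_ring n\<^esub> g = f + g"
  "\<zero>\<^bsub>poly_ring n\<^esub> = 0" "\<one>\<^bsub>poly_ring n\<^esub> = 1"
  by (simp_all add: poly_ring_def)

lemma poly_ring_pow [simp]: "f [^]\<^bsub>poly_ring n\<^esub> (q::nat) = f ^ q"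
  by (induction q) (simp_all add: mult.commute)

lemma carrier_poly_ring:
  "f \<in> carrier (poly_ring n) \<longleftrightarrow> (\<forall>m\<in>Poly_Mapping.keys f. mon_in n m)"
  by (simp add: poly_ring_def)

lemma mon_in_add: "mon_in n (u + v) \<longleftrightarrow> mon_in n u \<and> mon_in n v"
  by (auto simp: mon_in_def in_keys_iff lookup_add subset_iff)

lemma keys_add_monomial:
  fixes u v :: monomial
  shows "Poly_Mapping.keys (u + v) = Poly_Mapping.keys u \<union> Poly_Mapping.keys v"
  by (auto simp: in_keys_iff lookup_add)

lemma mon_degree_add: "mon_degree (u + v) = mon_degree u + mon_degree v"
  unfolding mon_degree_def
  using setsum_keys_plus_distrib[of "\<lambda>_ c. c" u v] by simp

lemma in_keys_mult:
  assumes "w \<in> Poly_Mapping.keys (f * g)"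
  obtains u v where "u \<in> Poly_Mapping.keys f" "v \<in> Poly_Mapping.keys g" "w = u + v"
  using assms keys_mult[of f g] by blast

lemma poly_ring_idealI:
  fixes J :: "'k::field polynomial set"
  assumes carr: "J \<subseteq> carrier (poly_ring n)" and zero: "0 \<in> J"
    and add: "\<And>f g. f \<in> J \<Longrightarrow> g \<in> J \<Longrightarrow> f + g \<in> J"
    and mult: "\<And>f g. f \<in> J \<Longrightarrow> g \<in> carrier (poly_ring n) \<Longrightarrow> g * f \<in> J"
  shows "ideal J (poly_ring n)"
proof -
  interpret cring "poly_ring n :: 'k polynomial ring" by (rule cring_poly_ring)
  have neg: "- f \<in> J" if "f \<in> J" for f
  proof -
    have "- 1 \<in> carrier (poly_ring n :: 'k polynomial ring)"
      by (simp add: carrier_poly_ring mon_in_def)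
    from mult[OF that this] show ?thesis by simp
  qed
  have inv: "inv\<^bsub>add_monoid (poly_ring n)\<^esub> f = - f" if "f \<in> J" for f
  proof -
    have "\<ominus>\<^bsub>poly_ring n\<^esub> f = - f"
      using that neg carr by (intro minus_equality) auto
    then show ?thesis by (simp add: a_inv_def)
  qed
  show ?thesis
  proof (rule idealI[OF ring_axioms])
    show "subgroup J (add_monoid (poly_ring n))"
      using carr zero add neg inv by (intro subgroup.intro) auto
    show "f \<otimes>\<^bsub>poly_ring n\<^esub> g \<in> J" if "f \<in> J" "g \<in> carrier (poly_ring n)" for f g
      using mult[OF that] by (simp add: mult.commute)
  qed (use mult in auto)
qed

lemma poly_ring_ideal_sum:
  assumes "ideal J (poly_ring n)" "\<And>x. x \<in> A \<Longrightarrow> h x \<in> J"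
  shows "sum h A \<in> J"
proof -
  interpret J: ideal J "poly_ring n" by fact
  have "0 \<in> J" using additive_subgroup.zero_closed[OF J.is_additive_subgroup] by simp
  moreover have "f + g \<in> J" if "f \<in> J" "g \<in> J" for f g using additive_subgroup.a_closed[OF J.is_additive_subgroup that] by simp
  ultimately show ?thesis
    using assms(2) by (induction A rule: infinite_finite_induct) auto
qed

lemma lookup_sum_single:
  assumes "finite A"
  shows "Poly_Mapping.lookup (\<Sum>m\<in>A. Poly_Mapping.single m (c m)) w = (if w \<in> A then c w else 0)"
  using assms by (simp add: lookup_sum lookup_single when_def)

lemma sum_single_keys:
  "(\<Sum>m\<in>Poly_Mapping.keys f. Poly_Mapping.single m (Poly_Mapping.lookup f m)) = f"
  by (rule poly_mapping_eqI) (simp add: lookup_sum_single in_keys_iff)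

lemma split_keys:
  fixes f :: "'a \<Rightarrow>\<^sub>0 'b::comm_monoid_add"
  obtains g h where "f = g + h" "Poly_Mapping.keys g = Poly_Mapping.keys f \<inter> A"
    "Poly_Mapping.keys h = Poly_Mapping.keys f - A"
proof -
  let ?s = "\<lambda>B. \<Sum>m\<in>B. Poly_Mapping.single m (Poly_Mapping.lookup f m)"
  have "f = ?s (Poly_Mapping.keys f)" by (simp add: sum_single_keys)
  also have "\<dots> = ?s (Poly_Mapping.keys f \<inter> A) + ?s (Poly_Mapping.keys f - A)"
    by (subst sum.Int_Diff[of _ _ A]) auto
  finally show ?thesis
    by (rule that) (auto simp: in_keys_iff lookup_sum_single split: if_splits)
qed

text \<open>The ideals that contain the terms of their elements. This closure condition passes to
  products and intersections more directly than generation by monomials, to which it is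
  equivalent.\<close>
definition monomial_ideal :: "nat \<Rightarrow> 'k::field polynomial set \<Rightarrow> bool"
  where "monomial_ideal n J \<longleftrightarrow> ideal J (poly_ring n) \<and>
    (\<forall>f\<in>J. \<forall>m\<in>Poly_Mapping.keys f. Poly_Mapping.single m 1 \<in> J)"

lemma monomial_idealD:
  assumes "monomial_ideal n J"
  shows "ideal J (poly_ring n)"
    and "f \<in> J \<Longrightarrow> m \<in> Poly_Mapping.keys f \<Longrightarrow> Poly_Mapping.single m 1 \<in> J"
  using assms by (auto simp: monomial_ideal_def)

lemma monomial_ideal_carrier: "monomial_ideal n (carrier (poly_ring n))"
proof -
  interpret cring "poly_ring n" by (rule cring_poly_ring)
  show ?thesis by (auto simp: monomial_ideal_def oneideal carrier_poly_ring)
qed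

lemma monomial_ideal_prod:
  fixes I J :: "'k::field polynomial set"
  assumes I: "monomial_ideal n I" and J: "monomial_ideal n J"
  shows "monomial_ideal n (I \<cdot>\<^bsub>poly_ring n\<^esub> J)"
proof -
  interpret cring "poly_ring n :: 'k polynomial ring" by (rule cring_poly_ring)
  have "Poly_Mapping.single m 1 \<in> I \<cdot>\<^bsub>poly_ring n\<^esub> J"
    if "f \<in> I \<cdot>\<^bsub>poly_ring n\<^esub> J" "m \<in> Poly_Mapping.keys f" for f m
    using that
  proof (induction arbitrary: m)
    case (prod i j)
    obtain u v where uv: "u \<in> Poly_Mapping.keys i" "v \<in> Poly_Mapping.keys j" "m = u + v"
      using prod.prems by (auto elim: in_keys_mult)
    have "Poly_Mapping.single u 1 \<otimes>\<^bsub>poly_ring n\<^esub> Poly_Mapping.single v 1 \<in> I \<cdot>\<^bsub>poly_ring n\<^esub> J"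
      using monomial_idealD(2)[OF I prod.hyps(1) uv(1)] monomial_idealD(2)[OF J prod.hyps(2) uv(2)]
      by (rule ideal_prod.prod)
    then show ?case by (simp add: mult_single uv(3))
  next
    case (sum f g)
    then show ?case using Poly_Mapping.keys_add[of f g] by auto
  qed
  then show ?thesis
    using ideal_prod_is_ideal monomial_idealD(1)[OF I] monomial_idealD(1)[OF J]
    by (simp add: monomial_ideal_def)
qed

lemma monomial_ideal_pow:
  "monomial_ideal n P \<Longrightarrow> monomial_ideal n (P [^]\<^bsub>ideals_set (poly_ring n)\<^esub> (q::nat))"
  by (induction q) (simp_all add: monomial_ideal_carrier monomial_ideal_prod)

lemma monomial_ideal_Inter:
  fixes \<J> :: "'k::field polynomial set set"
  assumes "\<And>J. J \<in> \<J> \<Longrightarrow> monomial_ideal n J"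
  shows "monomial_ideal n (carrier (poly_ring n) \<inter> \<Inter>\<J>)"
proof -
  interpret cring "poly_ring n :: 'k polynomial ring" by (rule cring_poly_ring)
  have "ideal (\<Inter>(insert (carrier (poly_ring n)) \<J>)) (poly_ring n)"
    using assms oneideal by (intro i_Intersect) (auto simp: monomial_ideal_def)
  then show ?thesis using assms by (auto simp: monomial_ideal_def carrier_poly_ring)
qed

text \<open>For \<open>F \<subseteq> {1..n}\<close>, this is the ideal generated by the variables \<open>x\<^sub>i\<close> with \<open>i \<in> F\<close>.\<close>
definition variable_ideal :: "nat \<Rightarrow> nat set \<Rightarrow> 'k::field polynomial set"
  where "variable_ideal n F =
    {f \<in> carrier (poly_ring n). \<forall>m\<in>Poly_Mapping.keys f. Poly_Mapping.keys m \<inter> F \<noteq> {}}"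

lemma monomial_ideal_variable_ideal:
  "monomial_ideal n (variable_ideal n F :: 'k::field polynomial set)"
proof -
  interpret cring "poly_ring n :: 'k polynomial ring" by (rule cring_poly_ring)
  have "ideal (variable_ideal n F :: 'k polynomial set) (poly_ring n)"
  proof (rule poly_ring_idealI)
    fix f g :: "'k polynomial"
    assume f: "f \<in> variable_ideal n F"
    show "f + g \<in> variable_ideal n F" if "g \<in> variable_ideal n F"
      using f that Poly_Mapping.keys_add[of f g] by (auto simp: variable_ideal_def carrier_poly_ring)
    show "g * f \<in> variable_ideal n F" if "g \<in> carrier (poly_ring n)"
    proof -
      have "mon_in n w \<and> Poly_Mapping.keys w \<inter> F \<noteq> {}" if w: "w \<in> Poly_Mapping.keys (g * f)" for w
      proof -
        obtain u v where uv: "u \<in> Poly_Mapping.keys g" "v \<in> Poly_Mapping.keys f" "w = u + v"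
          using w by (rule in_keys_mult)
        then have "mon_in n u" "mon_in n v" "Poly_Mapping.keys v \<inter> F \<noteq> {}"
          using f \<open>g \<in> carrier (poly_ring n)\<close> by (auto simp: variable_ideal_def carrier_poly_ring)
        then show ?thesis unfolding uv(3) mon_in_add keys_add_monomial by blast
      qed
      then show ?thesis by (simp add: variable_ideal_def carrier_poly_ring)
    qed
  qed (auto simp: variable_ideal_def carrier_poly_ring)
  then show ?thesis by (auto simp: monomial_ideal_def variable_ideal_def carrier_poly_ring)
qed

text \<open>A polynomial lies outside the ideal iff its part free of the variables in \<open>F\<close> is nonzero. These
  parts multiply like the polynomials, and the polynomial ring is a domain.\<close>
lemma primeideal_variable_ideal:
  "primeideal (variable_ideal n F :: 'k::field polynomial set) (poly_ring n)"
proof -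
  let ?P = "variable_ideal n F :: 'k polynomial set"
  interpret cring "poly_ring n :: 'k polynomial ring" by (rule cring_poly_ring)
  have id: "ideal ?P (poly_ring n)"
    using monomial_ideal_variable_ideal by (rule monomial_idealD)
  define A where "A = {m :: monomial. Poly_Mapping.keys m \<inter> F = {}}"
  have A: "f \<in> ?P \<longleftrightarrow> f \<in> carrier (poly_ring n) \<and> Poly_Mapping.keys f \<inter> A = {}" for f
    by (auto simp: variable_ideal_def A_def)
  have A_add: "u + v \<in> A \<longleftrightarrow> u \<in> A \<and> v \<in> A" for u v
    by (auto simp: A_def keys_add_monomial)
  have prime: "f \<in> ?P \<or> g \<in> ?P"
    if f: "f \<in> carrier (poly_ring n)" and g: "g \<in> carrier (poly_ring n)" and fg: "f * g \<in> ?P"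
    for f g
  proof (rule ccontr)
    assume not: "\<not> (f \<in> ?P \<or> g \<in> ?P)"
    obtain f0 f1 where f': "f = f0 + f1" "Poly_Mapping.keys f0 = Poly_Mapping.keys f \<inter> A"
      "Poly_Mapping.keys f1 = Poly_Mapping.keys f - A" by (rule split_keys)
    obtain g0 g1 where g': "g = g0 + g1" "Poly_Mapping.keys g0 = Poly_Mapping.keys g \<inter> A"
      "Poly_Mapping.keys g1 = Poly_Mapping.keys g - A" by (rule split_keys)
    have "f0 \<noteq> 0" "g0 \<noteq> 0" using not f g A f'(2) g'(2) by auto
    then have "f0 * g0 \<noteq> 0" by simp
    then obtain m where m: "m \<in> Poly_Mapping.keys (f0 * g0)"
      by fastforce
    then have mA: "m \<in> A" using f'(2) g'(2) by (auto elim!: in_keys_mult simp: A_add)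
    \<comment> \<open>A product with a factor in \<open>f\<^sub>1\<close> or \<open>g\<^sub>1\<close> involves a variable in \<open>F\<close> and cannot cancel \<open>m\<close>.\<close>
    have "m \<notin> Poly_Mapping.keys (f1 * g)" "m \<notin> Poly_Mapping.keys (f0 * g1)"
      using mA f'(3) g'(3) by (auto elim!: in_keys_mult simp: A_add)
    moreover have "f * g = f0 * g0 + (f0 * g1 + f1 * g)" by (simp add: f'(1) g'(1) algebra_simps)
    ultimately have "m \<in> Poly_Mapping.keys (f * g)" using m by (simp add: in_keys_iff lookup_add)
    then show False using fg mA A by blast
  qed
  have "(1 :: 'k polynomial) \<in> carrier (poly_ring n) - ?P"
    by (simp add: variable_ideal_def carrier_poly_ring mon_in_def)
  then have "carrier (poly_ring n) \<noteq> ?P" by blast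
  then show ?thesis using id prime by (intro primeidealI) (auto simp: cring_axioms)
qed

lemma Idl_monomials:
  fixes M :: "monomial set"
  assumes M: "\<And>m. m \<in> M \<Longrightarrow> mon_in n m"
  shows "Idl\<^bsub>poly_ring n\<^esub> {Poly_Mapping.single m (1::'k::field) | m. m \<in> M} =
    {f \<in> carrier (poly_ring n). \<forall>w\<in>Poly_Mapping.keys f. \<exists>m\<in>M. \<exists>u. w = m + u}"
    (is "Idl\<^bsub>_\<^esub> ?G = ?J")
proof
  interpret cring "poly_ring n :: 'k polynomial ring" by (rule cring_poly_ring)
  have G: "?G \<subseteq> carrier (poly_ring n)" using M by (auto simp: carrier_poly_ring)
  have "ideal ?J (poly_ring n)"
  proof (rule poly_ring_idealI)
    fix f g :: "'k polynomial"
    assume f: "f \<in> ?J"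
    show "f + g \<in> ?J" if "g \<in> ?J"
      using f that Poly_Mapping.keys_add[of f g] unfolding carrier_poly_ring by blast
    show "g * f \<in> ?J" if g: "g \<in> carrier (poly_ring n)"
    proof -
      have "mon_in n w \<and> (\<exists>m\<in>M. \<exists>u. w = m + u)" if w: "w \<in> Poly_Mapping.keys (g * f)" for w
      proof -
        obtain a b where ab: "a \<in> Poly_Mapping.keys g" "b \<in> Poly_Mapping.keys f" "w = a + b"
          using w by (rule in_keys_mult)
        moreover obtain m u where "m \<in> M" "b = m + u" using f ab(2) by blast
        moreover have "mon_in n a" "mon_in n b" using f g ab by (auto simp: carrier_poly_ring)
        ultimately show ?thesis using mon_in_add add.left_commute by metis
      qed
      then show ?thesis by (auto simp: carrier_poly_ring)
    qed
  qed (auto simp: carrier_poly_ring)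
  moreover have "\<exists>m'\<in>M. \<exists>u. m = m' + u" if "m \<in> M" for m
    using that by (intro bexI[of _ m] exI[of _ 0]) auto
  then have "?G \<subseteq> ?J" using G by auto
  ultimately show "Idl\<^bsub>poly_ring n\<^esub> ?G \<subseteq> ?J" by (rule genideal_minimal)
  have id: "ideal (Idl\<^bsub>poly_ring n\<^esub> ?G) (poly_ring n)" using G by (rule genideal_ideal)
  show "?J \<subseteq> Idl\<^bsub>poly_ring n\<^esub> ?G"
  proof
    fix f assume f: "f \<in> ?J"
    have "Poly_Mapping.single w (Poly_Mapping.lookup f w) \<in> Idl\<^bsub>poly_ring n\<^esub> ?G"
      if w: "w \<in> Poly_Mapping.keys f" for w
    proof -
      obtain m u where mu: "m \<in> M" "w = m + u" using f w by blast
      have "mon_in n u" using f w mu(2) mon_in_add by (auto simp: carrier_poly_ring)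
      then have "Poly_Mapping.single u (Poly_Mapping.lookup f w) \<in> carrier (poly_ring n)"
        by (simp add: carrier_poly_ring)
      moreover have "Poly_Mapping.single m 1 \<in> Idl\<^bsub>poly_ring n\<^esub> ?G"
        using genideal_self[OF G] mu(1) by blast
      ultimately show ?thesis
        using ideal.I_r_closed[OF id] by (fastforce simp: mult_single mu(2))
    qed
    then have "(\<Sum>w\<in>Poly_Mapping.keys f. Poly_Mapping.single w (Poly_Mapping.lookup f w))
        \<in> Idl\<^bsub>poly_ring n\<^esub> ?G"
      by (intro poly_ring_ideal_sum[OF id])
    then show "f \<in> Idl\<^bsub>poly_ring n\<^esub> ?G" by (simp add: sum_single_keys)
  qed
qed

lemma squarefree_divides_iff:
  assumes "squarefree_mon m"
  shows "(\<exists>u. w = m + u) \<longleftrightarrow> Poly_Mapping.keys m \<subseteq> Poly_Mapping.keys w"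
proof
  assume sub: "Poly_Mapping.keys m \<subseteq> Poly_Mapping.keys w"
  have "Poly_Mapping.lookup m i \<le> Poly_Mapping.lookup w i" for i
  proof (cases "i \<in> Poly_Mapping.keys m")
    case True
    then have "i \<in> Poly_Mapping.keys w" using sub by blast
    then have "Poly_Mapping.lookup w i \<noteq> 0" by (simp add: in_keys_iff)
    then show ?thesis using assms unfolding squarefree_mon_def by (meson le_trans less_one not_le)
  qed (simp add: in_keys_iff)
  then have "w = m + (w - m)" by (intro poly_mapping_eqI) (simp add: lookup_add lookup_minus)
  then show "\<exists>u. w = m + u" ..
qed (auto simp: keys_add_monomial)

text \<open>A monomial \<open>w\<close> lies outside the ideal iff no generator uses only variables of \<open>w\<close>, that is, iff
  the variables not in \<open>w\<close> meet every generator; the prime ideal generated by these variables does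
  not contain \<open>w\<close>.\<close>
lemma squarefree_ideal_eq_Inter:
  fixes M :: "monomial set"
  assumes M: "\<And>m. m \<in> M \<Longrightarrow> mon_in n m \<and> squarefree_mon m"
  shows "Idl\<^bsub>poly_ring n\<^esub> {Poly_Mapping.single m (1::'k::field) | m. m \<in> M} =
    carrier (poly_ring n) \<inter>
      \<Inter>(variable_ideal n ` {F. F \<subseteq> {1..n} \<and> (\<forall>m\<in>M. Poly_Mapping.keys m \<inter> F \<noteq> {})})"
    (is "?L = ?R")
proof -
  have L: "?L = {f \<in> carrier (poly_ring n). \<forall>w\<in>Poly_Mapping.keys f.
      \<exists>m\<in>M. Poly_Mapping.keys m \<subseteq> Poly_Mapping.keys w}"
    using Idl_monomials[of M n] M squarefree_divides_iff by auto
  show ?thesis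
  proof
    show "?L \<subseteq> ?R" unfolding L variable_ideal_def by fast
    show "?R \<subseteq> ?L"
    proof
      fix f assume f: "f \<in> ?R"
      have "\<exists>m\<in>M. Poly_Mapping.keys m \<subseteq> Poly_Mapping.keys w" if w: "w \<in> Poly_Mapping.keys f" for w
      proof (rule ccontr)
        assume no: "\<not> ?thesis"
        let ?F = "{1..n} - Poly_Mapping.keys w"
        have "Poly_Mapping.keys m \<inter> ?F \<noteq> {}" if "m \<in> M" for m
          using no M[OF that] that unfolding mon_in_def by blast
        then have "f \<in> variable_ideal n ?F" using f by blast
        then show False using w unfolding variable_ideal_def by blast
      qed
      then show "f \<in> ?L" using f unfolding L by blast
    qed
  qed
qed

section \<open>The initial degree and the Waldschmidt constant\<close>

lemma homogeneous_mult:
  assumes "homogeneous d f" "homogeneous e g"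
  shows "homogeneous (d + e) (f * g)"
  using assms unfolding homogeneous_def by (auto elim!: in_keys_mult simp: mon_degree_add)

lemma single_one_nonzero [simp]: "Poly_Mapping.single m (1 :: 'k::zero_neq_one) \<noteq> 0"
  by (simp flip: keys_eq_empty)

lemma homogeneous_generators_monomials:
  fixes J :: "'k::field polynomial set"
  assumes J: "monomial_ideal n J"
  shows "homogeneous_generators n J {Poly_Mapping.single m 1 | m. Poly_Mapping.single m 1 \<in> J}"
    (is "homogeneous_generators n J ?G")
proof -
  interpret cring "poly_ring n :: 'k polynomial ring" by (rule cring_poly_ring)
  interpret J: ideal J "poly_ring n" using J by (rule monomial_idealD)
  have G: "?G \<subseteq> J" by blast
  then have Gc: "?G \<subseteq> carrier (poly_ring n)" using J.Icarr by blast
  have mon: "mon_in n m" if "Poly_Mapping.single m 1 \<in> J" for m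
    using J.Icarr[OF that] by (simp add: carrier_poly_ring)
  have "J \<subseteq> Idl\<^bsub>poly_ring n\<^esub> {Poly_Mapping.single m 1 | m. m \<in> {m. Poly_Mapping.single m 1 \<in> J}}"
  proof (subst Idl_monomials)
    have "\<exists>m\<in>{m. Poly_Mapping.single m 1 \<in> J}. \<exists>u. w = m + u"
      if "f \<in> J" "w \<in> Poly_Mapping.keys f" for f w
      using monomial_idealD(2)[OF J that] by (intro bexI[of _ w] exI[of _ 0]) auto
    then show "J \<subseteq> {f \<in> carrier (poly_ring n). \<forall>w\<in>Poly_Mapping.keys f.
        \<exists>m\<in>{m. Poly_Mapping.single m 1 \<in> J}. \<exists>u. w = m + u}"
      using J.Icarr by blast
  qed (use mon in auto)
  then have "J = Idl\<^bsub>poly_ring n\<^esub> ?G" using genideal_minimal[OF J.is_ideal G] by auto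
  then show ?thesis
    using Gc unfolding homogeneous_generators_def by (auto simp: homogeneous_def)
qed

text \<open>The terms of \<open>f\<close> have degree \<open>d\<close> and belong to the generating set of all monomials in \<open>J\<close>.\<close>
lemma initial_degree_le:
  fixes J :: "'k::field polynomial set"
  assumes J: "monomial_ideal n J" and f: "f \<in> J" "f \<noteq> 0" "homogeneous d f"
  shows "\<alpha> n J \<le> d"
proof -
  obtain m where m: "m \<in> Poly_Mapping.keys f" using f(2) by fastforce
  then have "Poly_Mapping.single m 1 \<in> J" "homogeneous d (Poly_Mapping.single m (1::'k))"
    using monomial_idealD(2)[OF J f(1)] f(3) by (auto simp: homogeneous_def)
  then show ?thesis
    unfolding initial_degree_def using homogeneous_generators_monomials[OF J]
    by (intro Least_le) blast
qed

text \<open>A nonzero ideal is needed, because the zero ideal has no nonzero generators and its initial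
  degree is the least element of the empty set.\<close>
lemma initial_degree_attained:
  fixes J :: "'k::field polynomial set"
  assumes J: "monomial_ideal n J" and f: "f \<in> J" "f \<noteq> 0"
  obtains g where "g \<in> J" "g \<noteq> 0" "homogeneous (\<alpha> n J) g"
proof -
  interpret cring "poly_ring n :: 'k polynomial ring" by (rule cring_poly_ring)
  let ?P = "\<lambda>d. \<exists>G g. homogeneous_generators n J G \<and> g \<in> G \<and> homogeneous d g"
  obtain m where "m \<in> Poly_Mapping.keys f" using f(2) by fastforce
  then have "Poly_Mapping.single m 1 \<in> J" using monomial_idealD(2)[OF J f(1)] by blast
  then have "?P (mon_degree m)"
    using homogeneous_generators_monomials[OF J]
    by (intro exI[of _ "{Poly_Mapping.single m 1 | m. Poly_Mapping.single m 1 \<in> J}"]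
        exI[of _ "Poly_Mapping.single m 1"]) (auto simp: homogeneous_def)
  then have "?P (\<alpha> n J)" unfolding initial_degree_def by (rule LeastI)
  then obtain G g where G: "homogeneous_generators n J G" "g \<in> G" "homogeneous (\<alpha> n J) g" by blast
  then have "g \<in> J" "g \<noteq> 0"
    using genideal_self[of G] unfolding homogeneous_generators_def by auto
  then show ?thesis using G(3) that by blast
qed

definition squarefree_ideal :: "nat \<Rightarrow> 'k::field polynomial set \<Rightarrow> bool"
  where "squarefree_ideal n L \<longleftrightarrow> (\<exists>M. (\<forall>m\<in>M. mon_in n m \<and> squarefree_mon m) \<and>
    L = Idl\<^bsub>poly_ring n\<^esub> {Poly_Mapping.single m 1 | m. m \<in> M})"

lemma squarefree_ideal_decomp:
  fixes L :: "'k::field polynomial set"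
  assumes "squarefree_ideal n L"
  obtains \<P> where "min_prime_decomp (poly_ring n) L \<P>" "\<And>P. P \<in> \<P> \<Longrightarrow> monomial_ideal n P"
proof -
  interpret cring "poly_ring n :: 'k polynomial ring" by (rule cring_poly_ring)
  obtain M where M: "\<And>m. m \<in> M \<Longrightarrow> mon_in n m \<and> squarefree_mon m"
    and L: "L = Idl\<^bsub>poly_ring n\<^esub> {Poly_Mapping.single m 1 | m. m \<in> M}"
    using assms unfolding squarefree_ideal_def by auto
  let ?V = "variable_ideal n ` {F. F \<subseteq> {1..n} \<and> (\<forall>m\<in>M. Poly_Mapping.keys m \<inter> F \<noteq> {})}"
  have "finite ?V" by simp
  moreover have "primeideal P (poly_ring n)" if "P \<in> ?V" for P :: "'k polynomial set"
    using that primeideal_variable_ideal by blast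
  moreover have "L = carrier (poly_ring n) \<inter> \<Inter>?V"
    unfolding L using M by (rule squarefree_ideal_eq_Inter)
  ultimately obtain \<P> where V: "\<P> \<subseteq> ?V" and P: "min_prime_decomp (poly_ring n) L \<P>"
    by (rule min_prime_decomp_exists)
  have "monomial_ideal n P" if "P \<in> \<P>" for P
    using V that monomial_ideal_variable_ideal by fast
  then show ?thesis by (rule that[OF P])
qed

lemma monomial_ideal_symbolic_power:
  assumes "squarefree_ideal n L"
  shows "monomial_ideal n (symbolic_power (poly_ring n) L q)"
proof -
  obtain \<P> where P: "min_prime_decomp (poly_ring n) L \<P>" "\<And>P. P \<in> \<P> \<Longrightarrow> monomial_ideal n P"
    using assms by (rule squarefree_ideal_decomp) blast
  show ?thesis
    unfolding cring.symbolic_power_eq[OF cring_poly_ring P(1)]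
    by (rule monomial_ideal_Inter) (auto intro: monomial_ideal_pow P(2))
qed

text \<open>Powers of \<open>f\<close> ensure that the initial degrees of the symbolic powers are attained.\<close>
lemma symbolic_power_nonzero:
  assumes "squarefree_ideal n L" "f \<in> L" "f \<noteq> 0"
  shows "f ^ q \<in> symbolic_power (poly_ring n) L q" "f ^ q \<noteq> 0"
proof -
  obtain \<P> where P: "min_prime_decomp (poly_ring n) L \<P>"
    using assms(1) by (rule squarefree_ideal_decomp) blast
  show "f ^ q \<in> symbolic_power (poly_ring n) L q"
    using cring.pow_in_symbolic_power[OF cring_poly_ring P assms(2), of q] by simp
  show "f ^ q \<noteq> 0" using assms(3) by simp
qed

text \<open>The initial degrees of the symbolic powers are subadditive: the product of elements of least
  degree of the \<open>p\<close>-th and \<open>q\<close>-th symbolic powers lies in the \<open>(p + q)\<close>-th one, and it is nonzero.\<close>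
lemma waldschmidt_limit:
  fixes L :: "'k::field polynomial set"
  assumes L: "squarefree_ideal n L" and f: "f \<in> L" "f \<noteq> 0"
  shows "(\<lambda>q. real (\<alpha> n (symbolic_power (poly_ring n) L q)) / real q) \<longlonglongrightarrow> waldschmidt n L"
proof -
  let ?S = "symbolic_power (poly_ring n) L"
  obtain \<P> where P: "min_prime_decomp (poly_ring n) L \<P>"
    using L by (rule squarefree_ideal_decomp) blast
  have "\<alpha> n (?S (p + q)) \<le> \<alpha> n (?S p) + \<alpha> n (?S q)" for p q
  proof -
    obtain g where g: "g \<in> ?S p" "g \<noteq> 0" "homogeneous (\<alpha> n (?S p)) g"
      using monomial_ideal_symbolic_power[OF L] symbolic_power_nonzero[OF L f]
      by (rule initial_degree_attained)
    obtain h where h: "h \<in> ?S q" "h \<noteq> 0" "homogeneous (\<alpha> n (?S q)) h"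
      using monomial_ideal_symbolic_power[OF L] symbolic_power_nonzero[OF L f]
      by (rule initial_degree_attained)
    have "g * h \<in> ?S (p + q)"
      using cring.symbolic_power_mult_closed[OF cring_poly_ring P g(1) h(1)] by simp
    then show ?thesis
      using initial_degree_le[OF monomial_ideal_symbolic_power[OF L], of "g * h"]
        homogeneous_mult[OF g(3) h(3)] g(2) h(2) by simp
  qed
  then have "convergent (\<lambda>q. real (\<alpha> n (?S q)) / real q)"
    by (intro subadditive_convergent) (simp_all flip: of_nat_add)
  then show ?thesis unfolding waldschmidt_def by (simp add: convergent_LIMSEQ_iff)
qed

text \<open>A larger ideal has larger symbolic powers, and hence smaller initial degrees of these.\<close>
lemma waldschmidt_antimono:
  fixes L L' :: "'k::field polynomial set"
  assumes L: "squarefree_ideal n L" and L': "squarefree_ideal n L'" and sub: "L \<subseteq> L'"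
    and f: "f \<in> L" "f \<noteq> 0"
  shows "waldschmidt n L' \<le> waldschmidt n L"
proof -
  let ?S = "symbolic_power (poly_ring n)"
  obtain \<P> where P: "min_prime_decomp (poly_ring n) L \<P>"
    using L by (rule squarefree_ideal_decomp) blast
  obtain \<P>' where P': "min_prime_decomp (poly_ring n) L' \<P>'"
    using L' by (rule squarefree_ideal_decomp) blast
  have le: "\<alpha> n (?S L' q) \<le> \<alpha> n (?S L q)" for q
  proof -
    obtain g where g: "g \<in> ?S L q" "g \<noteq> 0" "homogeneous (\<alpha> n (?S L q)) g"
      using monomial_ideal_symbolic_power[OF L] symbolic_power_nonzero[OF L f]
      by (rule initial_degree_attained)
    moreover have "?S L q \<subseteq> ?S L' q"
      using cring.symbolic_power_mono[OF cring_poly_ring P P' sub] .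
    ultimately show ?thesis
      using initial_degree_le[OF monomial_ideal_symbolic_power[OF L']] by blast
  qed
  show ?thesis
  proof (rule LIMSEQ_le)
    show "(\<lambda>q. real (\<alpha> n (?S L' q)) / real q) \<longlonglongrightarrow> waldschmidt n L'"
      using waldschmidt_limit[OF L'] f sub by blast
    show "(\<lambda>q. real (\<alpha> n (?S L q)) / real q) \<longlonglongrightarrow> waldschmidt n L"
      using waldschmidt_limit[OF L f] .
  qed (use le in \<open>auto intro!: divide_right_mono\<close>)
qed

section \<open>Borel moves, joins and meets\<close>

text \<open>On square-free monomials that do not involve the index \<open>0\<close>, this agrees with the converse of
  \<open>borel_move\<close>. In contrast to \<open>borel_move\<close>, where the variables to be replaced must divide the
  first monomial, it is transitive by its form.\<close>
definition borel_le :: "monomial \<Rightarrow> monomial \<Rightarrow> bool"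
  where "borel_le m' m \<longleftrightarrow> list_all2 (\<le>) (mon_indices m') (mon_indices m)"

lemma borel_le_refl: "borel_le m m"
  by (simp add: borel_le_def list_all2_refl)

lemma borel_le_trans: "borel_le u v \<Longrightarrow> borel_le v w \<Longrightarrow> borel_le u w"
  unfolding borel_le_def by (rule list_all2_trans[of "(\<le>)" "(\<le>)" "(\<le>)"]) auto

lemma mon_indices_simps [simp]:
  "set (mon_indices m) = Poly_Mapping.keys m"
  "length (mon_indices m) = card (Poly_Mapping.keys m)"
  "sorted_wrt (<) (mon_indices m)"
  by (simp_all add: mon_indices_def)

lemma squarefree_lookup:
  assumes "squarefree_mon m" "i \<in> Poly_Mapping.keys m"
  shows "Poly_Mapping.lookup m i = 1"
  using assms unfolding squarefree_mon_def in_keys_iff by (metis le_antisym less_one not_le)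

lemma squarefree_degree:
  assumes "squarefree_mon m"
  shows "mon_degree m = card (Poly_Mapping.keys m)"
  unfolding mon_degree_def using squarefree_lookup[OF assms] by simp

lemma lookup_mon_of_indices:
  "Poly_Mapping.lookup (mon_of_indices xs) i = count_list xs i"
  by (induction xs) (auto simp: mon_of_indices_def lookup_add lookup_single)

lemma keys_mon_of_indices: "Poly_Mapping.keys (mon_of_indices xs) = set xs"
  by (auto simp: in_keys_iff lookup_mon_of_indices count_list_0_iff)

lemma count_list_distinct:
  assumes "distinct xs"
  shows "count_list xs i = (if i \<in> set xs then 1 else 0)"
  using assms by (induction xs) auto

lemma squarefree_mon_of_indices:
  assumes "distinct xs"
  shows "squarefree_mon (mon_of_indices xs)"
  using assms by (simp add: squarefree_mon_def lookup_mon_of_indices count_list_distinct)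

lemma mon_indices_mon_of_indices:
  assumes "sorted_wrt (<) xs"
  shows "mon_indices (mon_of_indices xs) = xs"
  using assms by (simp add: mon_indices_def keys_mon_of_indices sorted_list_of_set.idem_if_sorted_distinct strict_sorted_iff)

lemma mon_of_indices_mon_indices:
  assumes "squarefree_mon m"
  shows "mon_of_indices (mon_indices m) = m"
proof (rule poly_mapping_eqI)
  fix i
  have "distinct (mon_indices m)" using strict_sorted_iff mon_indices_simps(3) by blast
  then show "Poly_Mapping.lookup (mon_of_indices (mon_indices m)) i = Poly_Mapping.lookup m i"
    using squarefree_lookup[OF assms, of i]
    by (cases "i \<in> Poly_Mapping.keys m") (auto simp: lookup_mon_of_indices count_list_distinct in_keys_iff)
qed

text \<open>If \<open>js ! p > ks ! p\<close>, then \<open>js\<close> has more entries that are at least \<open>js ! p\<close> than \<open>ks\<close>: those from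
  position \<open>p\<close> on, against those after position \<open>p\<close>.\<close>
lemma list_all2_le_if_card_ge:
  fixes ks js :: "nat list"
  assumes "sorted_wrt (<) ks" "sorted_wrt (<) js" and len: "length js = length ks"
    and card: "\<And>k. card {j \<in> set js. k \<le> j} \<le> card {i \<in> set ks. k \<le> i}"
  shows "list_all2 (\<le>) js ks"
proof (rule list_all2_all_nthI[OF len])
  fix p assume p: "p < length js"
  show "js ! p \<le> ks ! p"
  proof (rule ccontr)
    let ?k = "js ! p" and ?s = "length js"
    assume not: "\<not> ?k \<le> ks ! p"
    have "inj_on ((!) js) {p..<?s}"
      using assms(2) by (intro inj_on_nth) (auto simp: strict_sorted_iff)
    then have "?s - p = card ((!) js ` {p..<?s})" by (simp add: card_image)
    also have "\<dots> \<le> card {j \<in> set js. ?k \<le> j}"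
      using assms(2) by (intro card_mono) (auto simp: strict_sorted_iff sorted_nth_mono)
    also have "\<dots> \<le> card {i \<in> set ks. ?k \<le> i}" by (rule card)
    also have "\<dots> \<le> card ((!) ks ` {Suc p..<?s})"
    proof (intro card_mono subsetI)
      fix i assume i: "i \<in> {i \<in> set ks. ?k \<le> i}"
      then obtain r where r: "r < ?s" "i = ks ! r" using len by (auto simp: in_set_conv_nth)
      have "p < r"
      proof (rule ccontr)
        assume "\<not> p < r"
        then have "ks ! r \<le> ks ! p"
          using assms(1) p len by (intro sorted_nth_mono) (auto simp: strict_sorted_iff)
        then show False using not i r by simp
      qed
      then show "i \<in> (!) ks ` {Suc p..<?s}" using r by auto
    qed simp
    also have "\<dots> \<le> ?s - Suc p" using card_image_le[of "{Suc p..<?s}" "(!) ks"] by simp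
    finally show False using p by simp
  qed
qed

definition degree_from :: "nat \<Rightarrow> monomial \<Rightarrow> nat"
  where "degree_from k m = (\<Sum>i\<in>Poly_Mapping.keys m. if k \<le> i then Poly_Mapping.lookup m i else 0)"

lemma degree_from_add: "degree_from k (u + v) = degree_from k u + degree_from k v"
  unfolding degree_from_def
  using setsum_keys_plus_distrib[of "\<lambda>i c. if k \<le> i then c else 0" u v] by simp

lemma degree_from_single: "degree_from k (Poly_Mapping.single i c) = (if k \<le> i then c else 0)"
  by (simp add: degree_from_def)

lemma degree_from_squarefree:
  assumes "squarefree_mon m"
  shows "degree_from k m = card {i \<in> Poly_Mapping.keys m. k \<le> i}"
proof -
  have "degree_from k m = (\<Sum>i\<in>Poly_Mapping.keys m. if k \<le> i then 1 else 0)"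
    unfolding degree_from_def using squarefree_lookup[OF assms] by (intro sum.cong) auto
  also have "\<dots> = card {i \<in> Poly_Mapping.keys m. k \<le> i}"
    by (simp flip: sum.inter_filter)
  finally show ?thesis .
qed

text \<open>A replacement of \<open>x\<^sub>b\<close> by \<open>x\<^sub>a\<close> with \<open>a < b\<close> preserves the total degree, and for no \<open>k\<close> does it
  increase the degree in the variables from \<open>x\<^sub>k\<close> on. For square-free monomials the latter degree
  counts the indices that are at least \<open>k\<close>.\<close>
lemma borel_move_imp_borel_le:
  assumes move: "borel_move m m'" and m: "squarefree_mon m" and m': "squarefree_mon m'"
  shows "borel_le m' m"
proof -
  let ?mon = "\<lambda>xs. (\<Sum>x\<leftarrow>xs. Poly_Mapping.single x 1) :: monomial"
  obtain ps where lt: "\<And>a b. (a, b) \<in> set ps \<Longrightarrow> a < b"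
    and eq: "m' + (\<Sum>(a, b)\<leftarrow>ps. Poly_Mapping.single b 1) =
      m + (\<Sum>(a, b)\<leftarrow>ps. Poly_Mapping.single a 1)"
    using move unfolding borel_move_def by blast
  have zero: "degree_from k 0 = 0" for k by (simp add: degree_from_def)
  have ps: "degree_from k (\<Sum>(a, b)\<leftarrow>ps. Poly_Mapping.single a 1)
      \<le> degree_from k (\<Sum>(a, b)\<leftarrow>ps. Poly_Mapping.single b 1)" for k
    using lt
  proof (induction ps)
    case (Cons p ps)
    obtain a b where p: "p = (a, b)" by fastforce
    then have "a < b" using Cons.prems by simp
    moreover have "degree_from k (\<Sum>(a, b)\<leftarrow>ps. Poly_Mapping.single a 1)
        \<le> degree_from k (\<Sum>(a, b)\<leftarrow>ps. Poly_Mapping.single b 1)"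
      using Cons.prems by (intro Cons.IH) simp
    ultimately show ?case by (simp add: p degree_from_add degree_from_single)
  qed (simp add: zero)
  have ps0: "degree_from 0 (\<Sum>(a, b)\<leftarrow>ps. Poly_Mapping.single a 1)
      = degree_from 0 (\<Sum>(a, b)\<leftarrow>ps. Poly_Mapping.single b 1)"
    by (induction ps) (auto simp: degree_from_add degree_from_single)
  have add: "degree_from k m' + degree_from k (\<Sum>(a, b)\<leftarrow>ps. Poly_Mapping.single b 1)
      = degree_from k m + degree_from k (\<Sum>(a, b)\<leftarrow>ps. Poly_Mapping.single a 1)" for k
    using arg_cong[OF eq, of "degree_from k"] by (simp add: degree_from_add)
  have "degree_from k m' \<le> degree_from k m" for k using add[of k] ps[of k] by simp
  moreover have "degree_from 0 m' = degree_from 0 m" using add[of 0] ps0 by simp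
  ultimately show ?thesis
    unfolding borel_le_def
    by (intro list_all2_le_if_card_ge) (simp_all add: degree_from_squarefree m m')
qed

lemma borel_move_keys:
  assumes "borel_move m m'"
  shows "i \<in> Poly_Mapping.keys m' \<Longrightarrow> \<exists>b\<in>Poly_Mapping.keys m. i \<le> b"
    and "0 \<notin> Poly_Mapping.keys m \<Longrightarrow> 0 \<notin> Poly_Mapping.keys m'"
proof -
  obtain ps where ps: "\<forall>(a, b)\<in>set ps. 1 \<le> a \<and> a < b \<and> b \<in> Poly_Mapping.keys m"
    and eq: "m' + (\<Sum>(a, b)\<leftarrow>ps. Poly_Mapping.single b 1) =
      m + (\<Sum>(a, b)\<leftarrow>ps. Poly_Mapping.single a 1)"
    using assms unfolding borel_move_def by blast
  have "Poly_Mapping.keys (\<Sum>(a, b)\<leftarrow>ps. Poly_Mapping.single a 1 :: monomial) = fst ` set ps"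
    by (induction ps) (auto simp: keys_add_monomial)
  then have sub: "Poly_Mapping.keys m' \<subseteq> Poly_Mapping.keys m \<union> fst ` set ps"
    using arg_cong[OF eq, of Poly_Mapping.keys] unfolding keys_add_monomial by auto
  have new: "1 \<le> i \<and> (\<exists>b\<in>Poly_Mapping.keys m. i \<le> b)" if i: "i \<in> fst ` set ps" for i
  proof -
    obtain b where "(i, b) \<in> set ps" using i by auto
    then have "1 \<le> i" "i < b" "b \<in> Poly_Mapping.keys m" using ps by auto
    then show ?thesis using less_imp_le by blast
  qed
  show "\<exists>b\<in>Poly_Mapping.keys m. i \<le> b" if "i \<in> Poly_Mapping.keys m'"
    using subsetD[OF sub that] new[of i] by auto
  show "0 \<notin> Poly_Mapping.keys m'" if "0 \<notin> Poly_Mapping.keys m"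
    using subsetD[OF sub, of 0] that new[of 0] by auto
qed

lemma borel_move_mon_in:
  assumes move: "borel_move m m'" and m: "mon_in n m"
  shows "mon_in n m'"
  unfolding mon_in_def
proof
  fix i assume i: "i \<in> Poly_Mapping.keys m'"
  obtain b where b: "b \<in> Poly_Mapping.keys m" "i \<le> b" using borel_move_keys(1)[OF move i] by blast
  have "0 \<notin> Poly_Mapping.keys m" using m by (auto simp: mon_in_def)
  then have "i \<noteq> 0" using borel_move_keys(2)[OF move] i by metis
  then show "i \<in> {1..n}" using b m by (force simp: mon_in_def)
qed

text \<open>The move replaces \<open>i\<^sub>p\<close> by \<open>j\<^sub>p\<close> at all positions \<open>p\<close> where the index lists differ.\<close>
lemma borel_le_imp_borel_move:
  assumes le: "borel_le m' m" and m: "squarefree_mon m" and m': "squarefree_mon m'"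
    and pos: "0 \<notin> Poly_Mapping.keys m'"
  shows "borel_move m m'"
proof -
  let ?ps = "\<lambda>js ks. filter (\<lambda>(a, b). a < b) (zip js ks)"
  have "list_all2 (\<le>) js ks \<Longrightarrow>
      mon_of_indices js + (\<Sum>(a, b)\<leftarrow>?ps js ks. Poly_Mapping.single b 1) =
      mon_of_indices ks + (\<Sum>(a, b)\<leftarrow>?ps js ks. Poly_Mapping.single a 1)" for js ks :: "nat list"
  proof (induction rule: list_all2_induct)
    case (Cons j js i ks)
    then show ?case by (cases "j = i") (simp_all add: mon_of_indices_def ac_simps)
  qed simp
  from this[OF le[unfolded borel_le_def]]
  have "m' + (\<Sum>(a, b)\<leftarrow>?ps (mon_indices m') (mon_indices m). Poly_Mapping.single b 1) =
      m + (\<Sum>(a, b)\<leftarrow>?ps (mon_indices m') (mon_indices m). Poly_Mapping.single a 1)"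
    by (simp add: mon_of_indices_mon_indices m m')
  moreover have "\<forall>(a, b)\<in>set (?ps (mon_indices m') (mon_indices m)).
      1 \<le> a \<and> a < b \<and> b \<in> Poly_Mapping.keys m"
  proof (safe, goal_cases)
    case (1 a b)
    then have "a \<in> Poly_Mapping.keys m'" by (auto dest: set_zip_leftD)
    then have "a \<noteq> 0" using pos by metis
    then show ?case by simp
  qed (auto dest: set_zip_rightD)
  ultimately show ?thesis unfolding borel_move_def by blast
qed

text \<open>This covers joins and meets, with \<open>f\<close> the maximum or the minimum: both preserve strict
  inequalities, so the combined list increases strictly and is the index list of its monomial.\<close>
lemma mon_of_indices_map2:
  assumes f: "\<And>a b c d. a < c \<Longrightarrow> b < d \<Longrightarrow> f a b < f c d" "\<And>a b. f a b \<in> {a, b}"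
    and u: "mon_in n u" "squarefree_mon u" "mon_degree u = s"
    and v: "mon_in n v" "squarefree_mon v" "mon_degree v = s"
  defines "w \<equiv> mon_of_indices (map2 f (mon_indices u) (mon_indices v))"
  shows "mon_in n w" "squarefree_mon w" "mon_degree w = s"
    and "mon_indices w = map2 f (mon_indices u) (mon_indices v)"
    and "length (mon_indices u) = s" "length (mon_indices v) = s"
proof -
  let ?xs = "map2 f (mon_indices u) (mon_indices v)"
  show len: "length (mon_indices u) = s" "length (mon_indices v) = s"
    using u v by (simp_all add: squarefree_degree)
  have "sorted_wrt (<) ?xs"
    using mon_indices_simps(3)[of u] mon_indices_simps(3)[of v] len f(1)
    unfolding sorted_wrt_iff_nth_less by simp
  then show idx: "mon_indices w = ?xs" and sf: "squarefree_mon w"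
    unfolding w_def
    by (simp_all add: mon_indices_mon_of_indices squarefree_mon_of_indices strict_sorted_iff)
  have "length (mon_indices w) = s" unfolding idx using len by simp
  then show "mon_degree w = s" using sf by (simp add: squarefree_degree)
  have "set ?xs \<subseteq> set (mon_indices u) \<union> set (mon_indices v)"
  proof
    fix x assume "x \<in> set ?xs"
    then obtain a b where ab: "(a, b) \<in> set (zip (mon_indices u) (mon_indices v))" "x = f a b"
      by auto
    then show "x \<in> set (mon_indices u) \<union> set (mon_indices v)"
      using f(2)[of a b] set_zip_leftD[OF ab(1)] set_zip_rightD[OF ab(1)] by auto
  qed
  then show "mon_in n w"
    using u(1) v(1) mon_indices_simps(1) unfolding mon_in_def idx[symmetric] by fastforce
qed

lemma mon_join_upper_bound:
  assumes u: "mon_in n u \<and> squarefree_mon u \<and> mon_degree u = s"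
    and v: "mon_in n v \<and> squarefree_mon v \<and> mon_degree v = s"
  shows "mon_in n (mon_join u v) \<and> squarefree_mon (mon_join u v) \<and> mon_degree (mon_join u v) = s"
    and "borel_le u (mon_join u v)" and "borel_le v (mon_join u v)"
proof -
  note * = mon_of_indices_map2[of max n u s v, folded mon_join_def]
  show "mon_in n (mon_join u v) \<and> squarefree_mon (mon_join u v) \<and> mon_degree (mon_join u v) = s"
    using * u v by (auto simp: max_def)
  have "mon_indices (mon_join u v) = map2 max (mon_indices u) (mon_indices v)"
    "length (mon_indices u) = s" "length (mon_indices v) = s"
    using * u v by (auto simp: max_def)
  then show "borel_le u (mon_join u v)" "borel_le v (mon_join u v)"
    unfolding borel_le_def by (auto simp: list_all2_conv_all_nth simp del: mon_indices_simps)
qed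

lemma mon_meet_lower_bound:
  assumes u: "mon_in n u \<and> squarefree_mon u \<and> mon_degree u = s"
    and v: "mon_in n v \<and> squarefree_mon v \<and> mon_degree v = s"
  shows "mon_in n (mon_meet u v) \<and> squarefree_mon (mon_meet u v) \<and> mon_degree (mon_meet u v) = s"
    and "borel_le (mon_meet u v) u" and "borel_le (mon_meet u v) v"
proof -
  note * = mon_of_indices_map2[of min n u s v, folded mon_meet_def]
  show "mon_in n (mon_meet u v) \<and> squarefree_mon (mon_meet u v) \<and> mon_degree (mon_meet u v) = s"
    using * u v by (auto simp: min_def)
  have "mon_indices (mon_meet u v) = map2 min (mon_indices u) (mon_indices v)"
    "length (mon_indices u) = s" "length (mon_indices v) = s"
    using * u v by (auto simp: min_def)
  then show "borel_le (mon_meet u v) u" "borel_le (mon_meet u v) v"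
    unfolding borel_le_def by (auto simp: list_all2_conv_all_nth simp del: mon_indices_simps)
qed

text \<open>Joins take \<open>r\<close> to be \<open>borel_le\<close>, and meets its converse.\<close>
lemma foldl_bound:
  assumes f: "\<And>a b. V a \<Longrightarrow> V b \<Longrightarrow> V (f a b) \<and> r a (f a b) \<and> r b (f a b)"
    and refl: "\<And>a. r a a" and trans: "\<And>a b c. r a b \<Longrightarrow> r b c \<Longrightarrow> r a c"
    and "V a" "\<And>b. b \<in> set bs \<Longrightarrow> V b"
  shows "V (foldl f a bs) \<and> (\<forall>b\<in>insert a (set bs). r b (foldl f a bs))"
  using assms(4,5)
proof (induction bs arbitrary: a)
  case (Cons b bs)
  then have "V (f a b)" "r a (f a b)" "r b (f a b)" using f by simp_all
  moreover from this(1) Cons.prems(2)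
  have "V (foldl f (f a b) bs) \<and> (\<forall>c\<in>insert (f a b) (set bs). r c (foldl f (f a b) bs))"
    by (intro Cons.IH) auto
  ultimately show ?case using trans by auto
qed (simp add: refl)

lemma mon_joins_upper_bound:
  assumes "ms \<noteq> []" and ms: "\<And>m. m \<in> set ms \<Longrightarrow> mon_in n m \<and> squarefree_mon m \<and> mon_degree m = s"
  shows "mon_in n (mon_joins ms) \<and> squarefree_mon (mon_joins ms) \<and> mon_degree (mon_joins ms) = s"
    and "m \<in> set ms \<Longrightarrow> borel_le m (mon_joins ms)"
proof -
  let ?V = "\<lambda>m. mon_in n m \<and> squarefree_mon m \<and> mon_degree m = s"
  have set: "set ms = insert (hd ms) (set (tl ms))" using assms(1) by (cases ms) auto
  have "?V (foldl mon_join (hd ms) (tl ms)) \<and>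
      (\<forall>m\<in>insert (hd ms) (set (tl ms)). borel_le m (foldl mon_join (hd ms) (tl ms)))"
    by (rule foldl_bound)
      (use mon_join_upper_bound ms set in \<open>blast intro: borel_le_refl borel_le_trans\<close>)+
  then show "?V (mon_joins ms)" "m \<in> set ms \<Longrightarrow> borel_le m (mon_joins ms)"
    unfolding mon_joins_def set by blast+
qed

lemma mon_meets_lower_bound:
  assumes "ms \<noteq> []" and ms: "\<And>m. m \<in> set ms \<Longrightarrow> mon_in n m \<and> squarefree_mon m \<and> mon_degree m = s"
  shows "mon_in n (mon_meets ms) \<and> squarefree_mon (mon_meets ms) \<and> mon_degree (mon_meets ms) = s"
    and "m \<in> set ms \<Longrightarrow> borel_le (mon_meets ms) m"
proof -
  let ?V = "\<lambda>m. mon_in n m \<and> squarefree_mon m \<and> mon_degree m = s"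
  have set: "set ms = insert (hd ms) (set (tl ms))" using assms(1) by (cases ms) auto
  have "?V (foldl mon_meet (hd ms) (tl ms)) \<and>
      (\<forall>m\<in>insert (hd ms) (set (tl ms)). borel_le (foldl mon_meet (hd ms) (tl ms)) m)"
    by (rule foldl_bound[where r = "\<lambda>a b. borel_le b a"])
      (use mon_meet_lower_bound ms set in \<open>blast intro: borel_le_refl borel_le_trans\<close>)+
  then show "?V (mon_meets ms)" "m \<in> set ms \<Longrightarrow> borel_le (mon_meets ms) m"
    unfolding mon_meets_def set by blast+
qed

section \<open>Comparison of the ideals\<close>

lemma squarefree_ideal_sfBorel:
  assumes "\<And>m. m \<in> T \<Longrightarrow> mon_in n m"
  shows "squarefree_ideal n (sfBorel n T)"
  unfolding squarefree_ideal_def sfBorel_def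
  by (intro exI[of _ "{m'. squarefree_mon m' \<and> (\<exists>m\<in>T. borel_move m m')}"] conjI)
    (use assms borel_move_mon_in in auto)

lemma sfBorel_gen_in:
  fixes T :: "monomial set"
  assumes T: "\<And>m. m \<in> T \<Longrightarrow> mon_in n m" and "m \<in> T" "squarefree_mon m'" "borel_move m m'"
  shows "Poly_Mapping.single m' (1::'k::field) \<in> sfBorel n T"
proof -
  interpret cring "poly_ring n :: 'k polynomial ring" by (rule cring_poly_ring)
  let ?G = "{Poly_Mapping.single m' (1::'k) | m'. squarefree_mon m' \<and> (\<exists>m\<in>T. borel_move m m')}"
  have "?G \<subseteq> carrier (poly_ring n)"
    using T borel_move_mon_in by (auto simp: carrier_poly_ring)
  then show ?thesis
    unfolding sfBorel_def using genideal_self[of ?G] assms(2-) by blast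
qed

text \<open>A Borel move of \<open>m\<close> lies below \<open>m\<close>, hence below \<open>m'\<close>, and so is a Borel move of \<open>m'\<close>.\<close>
lemma sfBorel_mono:
  fixes T T' :: "monomial set"
  assumes T: "\<And>m. m \<in> T \<Longrightarrow> mon_in n m \<and> squarefree_mon m"
    and T': "\<And>m. m \<in> T' \<Longrightarrow> mon_in n m \<and> squarefree_mon m"
    and le: "\<And>m. m \<in> T \<Longrightarrow> \<exists>m'\<in>T'. borel_le m m'"
  shows "(sfBorel n T :: 'k::field polynomial set) \<subseteq> sfBorel n T'"
proof -
  interpret cring "poly_ring n :: 'k polynomial ring" by (rule cring_poly_ring)
  let ?G = "\<lambda>T. {Poly_Mapping.single m' (1::'k) | m'. squarefree_mon m' \<and> (\<exists>m\<in>T. borel_move m m')}"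
  have G': "?G T' \<subseteq> carrier (poly_ring n)"
    using T' borel_move_mon_in by (auto simp: carrier_poly_ring)
  have "\<exists>m'\<in>T'. borel_move m' w" if w: "squarefree_mon w" "m \<in> T" "borel_move m w" for w m
  proof -
    obtain m' where m': "m' \<in> T'" "borel_le m m'" using le w(2) by blast
    have "borel_le w m" using borel_move_imp_borel_le w T by blast
    then have "borel_le w m'" using m'(2) borel_le_trans by blast
    moreover have "0 \<notin> Poly_Mapping.keys w"
      using borel_move_mon_in[OF w(3), of n] T[OF w(2)] by (auto simp: mon_in_def)
    ultimately show ?thesis using borel_le_imp_borel_move T' m' w(1) by blast
  qed
  then have "?G T \<subseteq> ?G T'" by blast
  then have "?G T \<subseteq> sfBorel n T'" unfolding sfBorel_def using genideal_self[OF G'] by blast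
  then show ?thesis
    unfolding sfBorel_def[of n T] using genideal_minimal[OF genideal_ideal[OF G']]
    unfolding sfBorel_def by blast
qed

lemma waldschmidt_sfBorel_antimono:
  fixes T T' :: "monomial set"
  assumes T: "\<And>m. m \<in> T \<Longrightarrow> mon_in n m \<and> squarefree_mon m" and "T \<noteq> {}"
    and T': "\<And>m. m \<in> T' \<Longrightarrow> mon_in n m \<and> squarefree_mon m"
    and le: "\<And>m. m \<in> T \<Longrightarrow> \<exists>m'\<in>T'. borel_le m m'"
  shows "waldschmidt n (sfBorel n T' :: 'k::field polynomial set) \<le>
    waldschmidt n (sfBorel n T :: 'k polynomial set)"
proof -
  obtain m where m: "m \<in> T" using assms(2) by blast
  \<comment> \<open>The trivial move provides a nonzero element of the smaller ideal.\<close>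
  have "borel_move m m"
    using T[OF m] by (intro borel_le_imp_borel_move borel_le_refl) (auto simp: mon_in_def)
  then have "Poly_Mapping.single m (1::'k) \<in> sfBorel n T"
    using sfBorel_gen_in[of T n m m] T m by blast
  moreover have "(sfBorel n T :: 'k polynomial set) \<subseteq> sfBorel n T'"
    using T T' le by (rule sfBorel_mono)
  ultimately show ?thesis
    using T T' by (intro waldschmidt_antimono squarefree_ideal_sfBorel) auto
qed

theorem theorem6p1:
  fixes n s :: nat and ms :: "monomial list" and I :: "'k::field polynomial set"
  assumes "ms \<noteq> []"
    and "\<And>m. m \<in> set ms \<Longrightarrow> mon_in n m \<and> squarefree_mon m \<and> mon_degree m = s"
    and "I = sfBorel n (set ms)"
  shows "waldschmidt n (sfBorel n {mon_joins ms} :: 'k polynomial set) \<le> waldschmidt n I \<and>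
         waldschmidt n I \<le> waldschmidt n (sfBorel n {mon_meets ms} :: 'k polynomial set)"
proof
  note joins = mon_joins_upper_bound[OF assms(1,2)]
  note meets = mon_meets_lower_bound[OF assms(1,2)]
  show "waldschmidt n (sfBorel n {mon_joins ms} :: 'k polynomial set) \<le> waldschmidt n I"
    unfolding assms(3) using assms(1,2) joins by (intro waldschmidt_sfBorel_antimono) auto
  show "waldschmidt n I \<le> waldschmidt n (sfBorel n {mon_meets ms} :: 'k polynomial set)"
    unfolding assms(3)
  proof (rule waldschmidt_sfBorel_antimono)
    show "\<exists>m'\<in>set ms. borel_le m m'" if "m \<in> {mon_meets ms}" for m
      using that meets(2) hd_in_set[OF assms(1)] by blast
  qed (use assms(2) meets(1) in auto)
qed

end
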